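(* Let $\mathcal K\colon(\mathbb Z,\le)\to\mathbf{Simp}^{\hookrightarrow}$ be a persistence simplicial complex whose transition maps are inclusions of finite simplicial complexes, and let $v\in\bigcup_i\mathcal K_i$ be a vertex with associated persistence vertex complex $\mathbf v$. For any $i\le j$ and $n\ge0$ there is an isomorphism of linear spaces $$\mathcal H_n^{i,j}(\mathcal K,\mathbf v)\cong H_n^{i,j}(\mathcal K,\mathbf v)$$ between the $(i,j)$-persistent local harmonic space and the $(i,j)$-persistent local homology group.
   Context: Coefficients are in $\mathbb R$; $C_n(K)$ has the inner product with the $n$-simplices as an orthonormal basis, and $C_n(K,L)=C_n(K)/C_n(L)$ has the quotient inner product (the quotient map restricted to $C_n(L)^\perp$ is an isometry). $f^\dagger$ denotes the Moore–Penrose pseudoinverse and $*$ the adjoint. $\mathbf{Simp}^{\hookrightarrow}$ is the category of simplicial complexes with inclusions; $\mathcal K$ is thus a filtration $\mathcal K_i\subseteq\mathcal K_j$, $i\le j$. Let $b=\min\{i\mid v\in\mathcal K_i\}$; $\mathbf v_i=\{v\}$ for $i\ge b$ and $\mathbf v_i=\emptyset$ for $i<b$. Let $\mathcal K_i^{\mathbf v}=\{\sigma\in\mathcal K_i\mid v\notin\sigma\}$ (equal to $\mathcal K_i$ for $i<b$). The inclusion of pairs induces $\bar f^{i,j}\colon C_*(\mathcal K_i,\mathcal K_i^{\mathbf v})\to C_*(\mathcal K_j,\mathcal K_j^{\mathbf v})$. Persistent local homology: $H_n^{i,j}(\mathcal K,\mathbf v)=\operatorname{im}\big(H_n(\mathcal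 K_i,\mathcal K_i^{\mathbf v})\to H_n(\mathcal K_j,\mathcal K_j^{\mathbf v})\big)$, the map induced by $\bar f^{i,j}$. Persistent local Laplacian: with $d^i_*,d^j_*$ the relative boundary operators, $\Theta^{i,j}_{n+1}=\{x\in C_{n+1}(\mathcal K_j,\mathcal K_j^{\mathbf v})\mid d^j_{n+1}x\in\operatorname{im}\bar f^{i,j}_n\}$, $\iota$ its inclusion into $C_{n+1}(\mathcal K_j,\mathcal K_j^{\mathbf v})$, and $\delta^{i,j}_{n+1}=(\bar f^{i,j}_n)^\dagger d^j_{n+1}\iota$, set $\Delta_n^{i,j}=\delta^{i,j}_{n+1}(\delta^{i,j}_{n+1})^*+(d^i_n)^*d^i_n$ on $C_n(\mathcal K_i,\mathcal K_i^{\mathbf v})$ (with $d^i_0=0$). The persistent local harmonic space is $\mathcal H_n^{i,j}(\mathcal K,\mathbf v)=\ker\Delta_n^{i,j}$. *)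

theory Defs
  imports "HOL-Analysis.Analysis" "HOL-Analysis.Finite_Function_Topology"
begin

section \<open>Real vector spaces and inner product spaces with explicit carriers\<close>

text \<open>Chain groups, quotients and homology depend on the complex, so they cannot be types.
  All maps below are HOL functions of which only the values on the carrier of the
  intended domain are relevant.\<close>

record 'x rvspace =
  vcarrier :: "'x set"
  vzero :: 'x
  vadd :: "'x \<Rightarrow> 'x \<Rightarrow> 'x"
  vscale :: "real \<Rightarrow> 'x \<Rightarrow> 'x"

record 'x ipspace = "'x rvspace" +
  vinner :: "'x \<Rightarrow> 'x \<Rightarrow> real"

definition linear_maps ::
  "('x, 'm) rvspace_scheme \<Rightarrow> ('y, 'k) rvspace_scheme \<Rightarrow> ('x \<Rightarrow> 'y) set" where
  "linear_maps V W = {f.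
     (\<forall>x\<in>vcarrier V. f x \<in> vcarrier W) \<and>
     (\<forall>x\<in>vcarrier V. \<forall>y\<in>vcarrier V. f (vadd V x y) = vadd W (f x) (f y)) \<and>
     (\<forall>a. \<forall>x\<in>vcarrier V. f (vscale V a x) = vscale W a (f x))}"

definition linearly_isomorphic ::
  "('x, 'm) rvspace_scheme \<Rightarrow> ('y, 'k) rvspace_scheme \<Rightarrow> bool" where
  "linearly_isomorphic V W \<longleftrightarrow>
     (\<exists>f\<in>linear_maps V W. bij_betw f (vcarrier V) (vcarrier W))"

definition subspace_on :: "('x, 'm) rvspace_scheme \<Rightarrow> 'x set \<Rightarrow> ('x, 'm) rvspace_scheme" where
  "subspace_on V S = V\<lparr>vcarrier := S\<rparr>"

definition kernel ::
  "('x, 'm) rvspace_scheme \<Rightarrow> ('y, 'k) rvspace_scheme \<Rightarrow> ('x \<Rightarrow> 'y) \<Rightarrow> 'x set" where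
  "kernel V W f = {x \<in> vcarrier V. f x = vzero W}"

subsection \<open>Quotients\<close>

definition coset :: "('x, 'm) rvspace_scheme \<Rightarrow> 'x set \<Rightarrow> 'x \<Rightarrow> 'x set" where
  "coset V W x = vadd V x ` W"

definition quotient_space :: "('x, 'm) rvspace_scheme \<Rightarrow> 'x set \<Rightarrow> 'x set rvspace" where
  "quotient_space V W =
     \<lparr>vcarrier = coset V W ` vcarrier V,
      vzero = W,
      vadd = (\<lambda>X Y. \<Union>x\<in>X. \<Union>y\<in>Y. coset V W (vadd V x y)),
      vscale = (\<lambda>a X. \<Union>x\<in>X. coset V W (vscale V a x))\<rparr>"

text \<open>The map \<open>V/W \<rightarrow> V'/W'\<close> induced by a map \<open>f\<close> from \<open>V\<close> to \<open>V'\<close> that sends \<open>W\<close> into \<open>W'\<close>;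
  the union is then over equal cosets.\<close>

definition quotient_map ::
  "('y, 'k) rvspace_scheme \<Rightarrow> 'y set \<Rightarrow> ('x \<Rightarrow> 'y) \<Rightarrow> 'x set \<Rightarrow> 'y set" where
  "quotient_map V' W' f X = (\<Union>x\<in>X. coset V' W' (f x))"

definition orthogonal_to :: "('x, 'm) ipspace_scheme \<Rightarrow> 'x set \<Rightarrow> 'x set" where
  "orthogonal_to V W = {x \<in> vcarrier V. \<forall>w\<in>W. vinner V x w = 0}"

text \<open>The inner product on \<open>V/W\<close> (for finite-dimensional \<open>W\<close>) that makes the quotient map
  restricted to the orthogonal complement of \<open>W\<close> an isometry: each coset
  has a unique representative in that complement.\<close>

definition quotient_inner ::
  "('x, 'm) ipspace_scheme \<Rightarrow> 'x set \<Rightarrow> 'x set \<Rightarrow> 'x set \<Rightarrow> real" where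
  "quotient_inner V W X Y =
     (THE r. \<exists>x \<in> X \<inter> orthogonal_to V W. \<exists>y \<in> Y \<inter> orthogonal_to V W. r = vinner V x y)"

definition quotient_ipspace :: "('x, 'm) ipspace_scheme \<Rightarrow> 'x set \<Rightarrow> 'x set ipspace" where
  "quotient_ipspace V W =
     rvspace.extend (quotient_space V W) (ipspace.fields (quotient_inner V W))"

subsection \<open>Adjoint and Moore--Penrose pseudoinverse\<close>

text \<open>Both exist and are unique on the carrier for linear maps between finite-dimensional
  inner product spaces.\<close>

definition adjoint_map ::
  "('x, 'm) ipspace_scheme \<Rightarrow> ('y, 'k) ipspace_scheme \<Rightarrow> ('x \<Rightarrow> 'y) \<Rightarrow> 'y \<Rightarrow> 'x" where
  "adjoint_map V W f y =
     (THE x. x \<in> vcarrier V \<and> (\<forall>z\<in>vcarrier V. vinner W (f z) y = vinner V z x))"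

definition self_adjoint_on :: "('x, 'm) ipspace_scheme \<Rightarrow> ('x \<Rightarrow> 'x) \<Rightarrow> bool" where
  "self_adjoint_on V f \<longleftrightarrow>
     (\<forall>x\<in>vcarrier V. \<forall>y\<in>vcarrier V. vinner V (f x) y = vinner V x (f y))"

definition is_pseudoinverse ::
  "('x, 'm) ipspace_scheme \<Rightarrow> ('y, 'k) ipspace_scheme \<Rightarrow> ('x \<Rightarrow> 'y) \<Rightarrow> ('y \<Rightarrow> 'x) \<Rightarrow> bool" where
  "is_pseudoinverse V W f g \<longleftrightarrow>
     g \<in> linear_maps W V \<and>
     (\<forall>x\<in>vcarrier V. f (g (f x)) = f x) \<and>
     (\<forall>y\<in>vcarrier W. g (f (g y)) = g y) \<and>
     self_adjoint_on W (\<lambda>y. f (g y)) \<and>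
     self_adjoint_on V (\<lambda>x. g (f x))"

definition pseudoinverse ::
  "('x, 'm) ipspace_scheme \<Rightarrow> ('y, 'k) ipspace_scheme \<Rightarrow> ('x \<Rightarrow> 'y) \<Rightarrow> 'y \<Rightarrow> 'x" where
  "pseudoinverse V W f = (SOME g. is_pseudoinverse V W f g)"

section \<open>Simplicial complexes and their real chain complexes\<close>

definition finite_simplicial_complex :: "'a set set \<Rightarrow> bool" where
  "finite_simplicial_complex K \<longleftrightarrow>
     finite K \<and>
     (\<forall>\<sigma>\<in>K. finite \<sigma> \<and> \<sigma> \<noteq> {}) \<and>
     (\<forall>\<sigma>\<in>K. \<forall>\<tau>. \<tau> \<noteq> {} \<and> \<tau> \<subseteq> \<sigma> \<longrightarrow> \<tau> \<in> K)"

definition simplices :: "'a set set \<Rightarrow> nat \<Rightarrow> 'a set set" where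
  "simplices K n = {\<sigma> \<in> K. card \<sigma> = n + 1}"

type_synonym 'a chain = "'a set \<Rightarrow>\<^sub>0 real"

definition chain_inner :: "'a chain \<Rightarrow> 'a chain \<Rightarrow> real" where
  "chain_inner c d =
     (\<Sum>\<sigma>\<in>Poly_Mapping.keys c. Poly_Mapping.lookup c \<sigma> * Poly_Mapping.lookup d \<sigma>)"

definition chain_space :: "'a set set \<Rightarrow> nat \<Rightarrow> 'a chain ipspace" where
  "chain_space K n =
     \<lparr>vcarrier = {c. Poly_Mapping.keys c \<subseteq> simplices K n},
      vzero = 0, vadd = (+), vscale = scaleR, vinner = chain_inner\<rparr>"

text \<open>A simplex is oriented by the linear order on the vertices, so the face omitting \<open>w\<close> gets
  the sign \<open>(-1)^k\<close>, where \<open>k\<close> is the position of \<open>w\<close>. The boundary in degree \<open>0\<close> is zero; the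
  truncated \<open>n - 1\<close> makes \<open>C_0\<close> its formal codomain, which affects neither its kernel
  nor \<open>d\<^sub>0\<^sup>*d\<^sub>0 = 0\<close>.\<close>

definition boundary :: "nat \<Rightarrow> 'a::linorder chain \<Rightarrow> 'a chain" where
  "boundary n c =
     (if n = 0 then 0
      else \<Sum>\<sigma>\<in>Poly_Mapping.keys c. \<Sum>w\<in>\<sigma>.
             Poly_Mapping.single (\<sigma> - {w})
               ((-1) ^ card {u \<in> \<sigma>. u < w} * Poly_Mapping.lookup c \<sigma>))"

subsection \<open>Relative chains and relative homology\<close>

definition rel_chain_space ::
  "'a set set \<Rightarrow> 'a set set \<Rightarrow> nat \<Rightarrow> 'a chain set ipspace" where
  "rel_chain_space K L n = quotient_ipspace (chain_space K n) (vcarrier (chain_space L n))"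

definition rel_boundary ::
  "'a::linorder set set \<Rightarrow> 'a set set \<Rightarrow> nat \<Rightarrow>
     'a chain set \<Rightarrow> 'a chain set" where
  "rel_boundary K L n =
     quotient_map (chain_space K (n - 1)) (vcarrier (chain_space L (n - 1))) (boundary n)"

definition rel_cycles ::
  "'a::linorder set set \<Rightarrow> 'a set set \<Rightarrow> nat \<Rightarrow> 'a chain set set" where
  "rel_cycles K L n =
     kernel (rel_chain_space K L n) (rel_chain_space K L (n - 1)) (rel_boundary K L n)"

definition rel_boundaries ::
  "'a::linorder set set \<Rightarrow> 'a set set \<Rightarrow> nat \<Rightarrow> 'a chain set set" where
  "rel_boundaries K L n =
     rel_boundary K L (n + 1) ` vcarrier (rel_chain_space K L (n + 1))"

definition rel_homology ::
  "'a::linorder set set \<Rightarrow> 'a set set \<Rightarrow> nat \<Rightarrow> 'a chain set set rvspace" where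
  "rel_homology K L n =
     quotient_space (subspace_on (rel_chain_space K L n) (rel_cycles K L n))
       (rel_boundaries K L n)"

text \<open>The maps induced by an inclusion of pairs into \<open>(K', L')\<close>; they depend only on the target.\<close>

definition rel_chain_incl ::
  "'a set set \<Rightarrow> 'a set set \<Rightarrow> nat \<Rightarrow> 'a chain set \<Rightarrow> 'a chain set" where
  "rel_chain_incl K' L' n =
     quotient_map (chain_space K' n) (vcarrier (chain_space L' n)) (\<lambda>c. c)"

definition rel_homology_incl ::
  "'a::linorder set set \<Rightarrow> 'a set set \<Rightarrow> nat \<Rightarrow>
     'a chain set set \<Rightarrow> 'a chain set set" where
  "rel_homology_incl K' L' n =
     quotient_map (subspace_on (rel_chain_space K' L' n) (rel_cycles K' L' n))
       (rel_boundaries K' L' n) (rel_chain_incl K' L' n)"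

section \<open>Persistence\<close>

definition persistence_complex :: "(int \<Rightarrow> 'a set set) \<Rightarrow> bool" where
  "persistence_complex K \<longleftrightarrow>
     (\<forall>i. finite_simplicial_complex (K i)) \<and> (\<forall>i j. i \<le> j \<longrightarrow> K i \<subseteq> K j)"

text \<open>The simplices of \<open>K\<^sub>i\<close> not containing \<open>v\<close>. Before the birth of \<open>v\<close> this is all of \<open>K\<^sub>i\<close>, so
  no case distinction on the birth time is needed.\<close>

definition avoiding :: "(int \<Rightarrow> 'a set set) \<Rightarrow> 'a \<Rightarrow> int \<Rightarrow> 'a set set" where
  "avoiding K v i = {\<sigma> \<in> K i. v \<notin> \<sigma>}"

definition local_chains ::
  "(int \<Rightarrow> 'a set set) \<Rightarrow> 'a \<Rightarrow> int \<Rightarrow> nat \<Rightarrow> 'a chain set ipspace" where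
  "local_chains K v i n = rel_chain_space (K i) (avoiding K v i) n"

definition local_boundary ::
  "(int \<Rightarrow> 'a::linorder set set) \<Rightarrow> 'a \<Rightarrow> int \<Rightarrow> nat \<Rightarrow>
     'a chain set \<Rightarrow> 'a chain set" where
  "local_boundary K v i n = rel_boundary (K i) (avoiding K v i) n"

definition local_incl ::
  "(int \<Rightarrow> 'a set set) \<Rightarrow> 'a \<Rightarrow> int \<Rightarrow> nat \<Rightarrow>
     'a chain set \<Rightarrow> 'a chain set" where
  "local_incl K v j n = rel_chain_incl (K j) (avoiding K v j) n"

subsection \<open>Persistent local homology\<close>

definition persistent_local_homology ::
  "(int \<Rightarrow> 'a::linorder set set) \<Rightarrow> 'a \<Rightarrow> int \<Rightarrow> int \<Rightarrow> nat \<Rightarrow>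
     'a chain set set rvspace" where
  "persistent_local_homology K v i j n =
     subspace_on (rel_homology (K j) (avoiding K v j) n)
       (rel_homology_incl (K j) (avoiding K v j) n `
          vcarrier (rel_homology (K i) (avoiding K v i) n))"

subsection \<open>Persistent local Laplacian\<close>

text \<open>\<open>theta K v i j n\<close> is \<open>\<Theta>\<close> in degree \<open>n + 1\<close>, and \<open>delta K v i j n\<close> is the map \<open>\<delta>\<close> from it to
  the local chains of \<open>K\<^sub>i\<close> in degree \<open>n\<close>.\<close>

definition theta ::
  "(int \<Rightarrow> 'a::linorder set set) \<Rightarrow> 'a \<Rightarrow> int \<Rightarrow> int \<Rightarrow> nat \<Rightarrow> 'a chain set ipspace" where
  "theta K v i j n =
     subspace_on (local_chains K v j (n + 1))
       {x \<in> vcarrier (local_chains K v j (n + 1)).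
          local_boundary K v j (n + 1) x \<in> local_incl K v j n ` vcarrier (local_chains K v i n)}"

definition delta ::
  "(int \<Rightarrow> 'a::linorder set set) \<Rightarrow> 'a \<Rightarrow> int \<Rightarrow> int \<Rightarrow> nat \<Rightarrow>
     'a chain set \<Rightarrow> 'a chain set" where
  "delta K v i j n x =
     pseudoinverse (local_chains K v i n) (local_chains K v j n) (local_incl K v j n)
       (local_boundary K v j (n + 1) x)"

definition persistent_local_laplacian ::
  "(int \<Rightarrow> 'a::linorder set set) \<Rightarrow> 'a \<Rightarrow> int \<Rightarrow> int \<Rightarrow> nat \<Rightarrow>
     'a chain set \<Rightarrow> 'a chain set" where
  "persistent_local_laplacian K v i j n x =
     vadd (local_chains K v i n)
       (delta K v i j n
          (adjoint_map (theta K v i j n) (local_chains K v i n) (delta K v i j n) x))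
       (adjoint_map (local_chains K v i n) (local_chains K v i (n - 1)) (local_boundary K v i n)
          (local_boundary K v i n x))"

definition persistent_local_harmonic ::
  "(int \<Rightarrow> 'a::linorder set set) \<Rightarrow> 'a \<Rightarrow> int \<Rightarrow> int \<Rightarrow> nat \<Rightarrow>
     'a chain set ipspace" where
  "persistent_local_harmonic K v i j n =
     subspace_on (local_chains K v i n)
       (kernel (local_chains K v i n) (local_chains K v i n)
          (persistent_local_laplacian K v i j n))"

end

theory Submission
  imports Defs
begin

text \<open>A relative chain of \<open>(K\<^sub>i, K\<^sub>i\<^sup>v)\<close> has a unique representative supported on the simplices
  containing \<open>v\<close>, and the quotient inner product is the inner product of these representatives.
  On representatives the inclusion \<open>C(K\<^sub>i) \<rightarrow> C(K\<^sub>j)\<close> is a coordinate inclusion, so its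
  pseudoinverse is the coordinate projection and \<open>\<delta>\<close> is the boundary \<open>d\<close> restricted to \<open>\<Theta>\<close>, with
  image \<open>B\<^sub>j \<inter> Z\<^sub>i\<close> (boundaries of stage \<open>j\<close> that are cycles of stage \<open>i\<close>). Hence
  \<open>ker \<Delta> = ker d \<inter> ker \<delta>\<^sup>*\<close> is the orthogonal complement of \<open>B\<^sub>j \<inter> Z\<^sub>i\<close> in \<open>Z\<^sub>i\<close>, while the
  persistent homology, being the image of \<open>Z\<^sub>i\<close> in \<open>Z\<^sub>j/B\<^sub>j\<close>, is \<open>Z\<^sub>i/(B\<^sub>j \<inter> Z\<^sub>i)\<close>.\<close>

section \<open>Presentations of vector spaces with explicit carriers\<close>

text \<open>\<open>presents V q R N\<close>: the map \<open>q\<close> induces an isomorphism from \<open>R/N\<close> onto \<open>V\<close>.\<close>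

definition presents ::
  "('x, 'm) rvspace_scheme \<Rightarrow> ('b::real_vector \<Rightarrow> 'x) \<Rightarrow> 'b set \<Rightarrow> 'b set \<Rightarrow> bool" where
  "presents V q R N \<longleftrightarrow>
     subspace R \<and> subspace N \<and> N \<subseteq> R \<and> vcarrier V = q ` R \<and> vzero V = q 0 \<and>
     (\<forall>x\<in>R. \<forall>y\<in>R. q x = q y \<longleftrightarrow> x - y \<in> N) \<and>
     (\<forall>x\<in>R. \<forall>y\<in>R. vadd V (q x) (q y) = q (x + y)) \<and>
     (\<forall>a. \<forall>x\<in>R. vscale V a (q x) = q (a *\<^sub>R x))"

lemma presentsD:
  assumes "presents V q R N"
  shows "subspace R" "subspace N" "N \<subseteq> R" "vcarrier V = q ` R" "vzero V = q 0"
    and "\<And>x y. x \<in> R \<Longrightarrow> y \<in> R \<Longrightarrow> q x = q y \<longleftrightarrow> x - y \<in> N"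
    and "\<And>x y. x \<in> R \<Longrightarrow> y \<in> R \<Longrightarrow> vadd V (q x) (q y) = q (x + y)"
    and "\<And>a x. x \<in> R \<Longrightarrow> vscale V a (q x) = q (a *\<^sub>R x)"
  using assms unfolding presents_def by auto

lemma presents_coset:
  assumes "presents V q R N" "U \<subseteq> R" "x \<in> R"
  shows "coset V (q ` U) (q x) = q ` ((+) x ` U)"
  unfolding coset_def image_image
  using assms by (intro image_cong) (auto simp: presentsD(7)[OF assms(1)])

text \<open>Equality under \<open>q\<close> determines representatives only modulo \<open>N\<close>;
  because \<open>N \<subseteq> U\<close>, this slack is absorbed by \<open>U\<close>.\<close>

lemma presents_coset_eq_iff:
  assumes p: "presents V q R N" and U: "subspace U" "N \<subseteq> U" "U \<subseteq> R" and x: "x \<in> R" and y: "y \<in> R"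
  shows "coset V (q ` U) (q x) = coset V (q ` U) (q y) \<longleftrightarrow> x - y \<in> U"
proof
  note R = presentsD(1)[OF p]
  assume "coset V (q ` U) (q x) = coset V (q ` U) (q y)"
  then have "q ` ((+) x ` U) = q ` ((+) y ` U)"
    using p U(3) x y by (simp add: presents_coset)
  moreover have "q x \<in> q ` ((+) x ` U)"
    using subspace_0[OF U(1)] by (force intro!: image_eqI[of _ _ x])
  ultimately obtain u where u: "u \<in> U" "q x = q (y + u)" by auto
  then have "x - (y + u) \<in> N"
    using presentsD(6)[OF p x, of "y + u"] U(3) y R by (auto intro: subspace_add)
  then have "(x - (y + u)) + u \<in> U"
    using U u(1) by (intro subspace_add) auto
  then show "x - y \<in> U" by simp
next
  assume d: "x - y \<in> U"
  have "(+) x ` U = (+) y ` U"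
  proof (intro equalityI subsetI)
    fix z assume "z \<in> (+) x ` U"
    then obtain u where "u \<in> U" "z = y + ((x - y) + u)" by auto
    then show "z \<in> (+) y ` U" using d U(1) by (blast intro: subspace_add)
  next
    fix z assume "z \<in> (+) y ` U"
    then obtain u where "u \<in> U" "z = x + (u - (x - y))" by auto
    then show "z \<in> (+) x ` U" using d U(1) by (blast intro: subspace_diff)
  qed
  then show "coset V (q ` U) (q x) = coset V (q ` U) (q y)"
    using p U(3) x y by (simp add: presents_coset)
qed

lemma presents_coset_self:
  assumes p: "presents V q R N" and U: "subspace U" "U \<subseteq> R" and x: "x \<in> R"
  shows "q x \<in> coset V (q ` U) (q x)"
  unfolding presents_coset[OF p U(2) x] image_image
  using subspace_0[OF U(1)] by (intro image_eqI[of _ _ 0]) auto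

text \<open>Third isomorphism theorem: (R/N)/(U/N) is R/U. \<open>quotient_space\<close> forms sums
  and multiples as unions over all representatives, so every choice has to yield the same
  coset.\<close>

lemma presents_quotient:
  assumes p: "presents V q R N" and U: "subspace U" "N \<subseteq> U" "U \<subseteq> R"
  shows "presents (quotient_space V (q ` U)) (\<lambda>x. coset V (q ` U) (q x)) R U"
proof -
  note R = presentsD(1)[OF p]
  let ?c = "\<lambda>x. coset V (q ` U) (q x)"
  have mem: "\<exists>u\<in>U. X = q (x + u)" if "X \<in> ?c x" "x \<in> R" for X x
    using that p U by (auto simp: presents_coset)
  have add: "(\<Union>X\<in>?c x. \<Union>Y\<in>?c y. coset V (q ` U) (vadd V X Y)) = ?c (x + y)"
    if xy: "x \<in> R" "y \<in> R" for x y
  proof -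
    have "coset V (q ` U) (vadd V X Y) = ?c (x + y)" if XY: "X \<in> ?c x" "Y \<in> ?c y" for X Y
    proof -
      obtain u u' where u: "u \<in> U" "u' \<in> U" "X = q (x + u)" "Y = q (y + u')"
        using mem[OF XY(1) xy(1)] mem[OF XY(2) xy(2)] by blast
      then have "x + u \<in> R" "y + u' \<in> R" using xy U(3) R by (auto intro: subspace_add)
      moreover have "(x + u) + (y + u') - (x + y) \<in> U"
        using u(1,2) U(1) by (simp add: algebra_simps subspace_add)
      ultimately show ?thesis
        using u xy R by (simp add: presentsD(7)[OF p] presents_coset_eq_iff[OF p U] subspace_add)
    qed
    \<comment> \<open>All cosets in the union agree, and its index sets are inhabited by
      \<open>q x\<close> and \<open>q y\<close>.\<close>
    then show ?thesis
      using presents_coset_self[OF p U(1,3)] xy by (fastforce)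
  qed
  have scale: "(\<Union>X\<in>?c x. coset V (q ` U) (vscale V a X)) = ?c (a *\<^sub>R x)"
    if x: "x \<in> R" for x a
  proof -
    have "coset V (q ` U) (vscale V a X) = ?c (a *\<^sub>R x)" if X: "X \<in> ?c x" for X
    proof -
      obtain u where u: "u \<in> U" "X = q (x + u)"
        using mem[OF X x] by blast
      then have "x + u \<in> R" using x U(3) R by (auto intro: subspace_add)
      moreover have "a *\<^sub>R (x + u) - a *\<^sub>R x \<in> U"
        using u(1) U(1) by (simp add: algebra_simps subspace_scale)
      ultimately show ?thesis
        using u x R by (simp add: presentsD(8)[OF p] presents_coset_eq_iff[OF p U] subspace_scale)
    qed
    then show ?thesis
      using presents_coset_self[OF p U(1,3)] x by fastforce
  qed
  have "coset V (q ` U) (q 0) = q ` U"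
    using presents_coset[OF p U(3) subspace_0[OF R]] by simp
  then show ?thesis
    using R U add scale presents_coset_eq_iff[OF p U]
    unfolding presents_def quotient_space_def
    by (auto simp: presentsD(4)[OF p])
qed

lemma presents_subspace_on:
  assumes "presents V q R N" "subspace S" "S \<subseteq> R"
  shows "presents (subspace_on V (q ` S)) q S (N \<inter> S)"
  using assms unfolding presents_def subspace_on_def
  by (auto simp: subspace_inter subspace_diff subset_iff)

text \<open>As \<open>S\<close> is a complement of \<open>N\<close> in \<open>R\<close>, every class
  has exactly one representative in \<open>S\<close>. This serves twice: for chains on simplices
  containing \<open>v\<close>, and for harmonic chains.\<close>

lemma presents_complement:
  assumes p: "presents V q R N" and S: "subspace S" "S \<subseteq> R" "N \<inter> S \<subseteq> {0}"
    and dec: "\<And>x. x \<in> R \<Longrightarrow> \<exists>s\<in>S. x - s \<in> N"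
  shows "presents V q S {0}"
proof -
  have "q ` R = q ` S"
  proof (intro equalityI subsetI)
    fix X assume "X \<in> q ` R"
    then obtain x where x: "x \<in> R" "X = q x" by auto
    then obtain s where "s \<in> S" "x - s \<in> N" using dec by blast
    then show "X \<in> q ` S" using presentsD(6)[OF p x(1), of s] S x by auto
  qed (use S in auto)
  moreover have "N \<inter> S = {0}"
    using S subspace_0[OF S(1)] subspace_0[OF presentsD(2)[OF p]] by auto
  ultimately have "subspace_on V (q ` S) = V"
    by (simp add: subspace_on_def flip: presentsD(4)[OF p])
  then show ?thesis
    using presents_subspace_on[OF p S(1,2)] \<open>N \<inter> S = {0}\<close> by simp
qed

text \<open>The map \<open>g\<close> is \<open>F\<close> on representatives; as it takes
  \<open>U\<close> into \<open>U'\<close>, all cosets in the union defining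
  \<open>quotient_map\<close> coincide. The boundary, the inclusion and the map on homology are all
  computed this way.\<close>

lemma presents_quotient_map:
  assumes p: "presents V q R N" and U: "subspace U" "N \<subseteq> U" "U \<subseteq> R"
    and p': "presents V' q' R' N'" and U': "subspace U'" "N' \<subseteq> U'" "U' \<subseteq> R'"
    and F: "\<And>x. x \<in> R \<Longrightarrow> F (q x) = q' (g x)" and "linear g" and g: "g ` R \<subseteq> R'" "g ` U \<subseteq> U'"
    and x: "x \<in> R"
  shows "quotient_map V' (q' ` U') F (coset V (q ` U) (q x)) = coset V' (q' ` U') (q' (g x))"
proof -
  interpret g: linear g by fact
  have "coset V' (q' ` U') (F X) = coset V' (q' ` U') (q' (g x))"
    if "X \<in> coset V (q ` U) (q x)" for X
  proof -
    obtain u where u: "u \<in> U" "X = q (x + u)"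
      using \<open>X \<in> _\<close> p U x by (auto simp: presents_coset)
    then have xu: "x + u \<in> R" using x U(3) presentsD(1)[OF p] by (auto intro: subspace_add)
    then have "g (x + u) - g x \<in> U'" using u(1) g(2) by (auto simp: g.add)
    moreover have "g (x + u) \<in> R'" "g x \<in> R'" using x xu g(1) by auto
    ultimately show ?thesis
      using u(2) xu by (simp add: F presents_coset_eq_iff[OF p' U'])
  qed
  then show ?thesis
    using presents_coset_self[OF p U(1,3) x] unfolding quotient_map_def by fastforce
qed

text \<open>Both \<open>q\<close> and \<open>q'\<close> are injective on the common
  \<open>R\<close>, so \<open>q'\<close> composed with the inverse of \<open>q\<close> is the
  isomorphism. The theorem is thereby reduced to finding one \<open>R\<close> that presents both
  spaces.\<close>

lemma presents_isomorphic:
  assumes p: "presents V q R {0}" and p': "presents V' q' R {0}"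
  shows "linearly_isomorphic V V'"
proof -
  note R = presentsD(1)[OF p]
  have inj: "inj_on q R" "inj_on q' R"
    using presentsD(6)[OF p] presentsD(6)[OF p'] by (auto intro!: inj_onI)
  let ?f = "\<lambda>X. q' (inv_into R q X)"
  have f: "?f (q x) = q' x" if "x \<in> R" for x using inj that by simp
  have "?f \<in> linear_maps V V'"
    unfolding linear_maps_def presentsD(4)[OF p] presentsD(4)[OF p']
    using R by (auto simp: presentsD(7,8)[OF p] presentsD(7,8)[OF p'] f subspace_add subspace_scale inj)
  moreover have "bij_betw ?f (vcarrier V) (vcarrier V')"
    unfolding presentsD(4)[OF p] presentsD(4)[OF p'] bij_betw_def inj_on_def
    using inj by (auto simp: image_image f inj_on_eq_iff)
  ultimately show ?thesis unfolding linearly_isomorphic_def by blast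
qed

section \<open>The inner product on chains\<close>

lemma lookup_scaleR [simp]:
  "Poly_Mapping.lookup (a *\<^sub>R c) k = a *\<^sub>R Poly_Mapping.lookup c k"
  for c :: "'a \<Rightarrow>\<^sub>0 'b::real_vector"
proof -
  have "finite {i. a *\<^sub>R Poly_Mapping.lookup c i \<noteq> 0}"
    by (rule finite_subset[OF _ finite_keys[of c]]) (auto simp: in_keys_iff)
  then show ?thesis unfolding scaleR_poly_mapping_def by simp
qed

text \<open>\<open>chain_inner\<close> sums over the support of its left argument; to compare two
  such sums, both are brought to a common index set.\<close>

lemma chain_inner_superset:
  assumes "finite S" "Poly_Mapping.keys c \<subseteq> S"
  shows "chain_inner c d = (\<Sum>\<sigma>\<in>S. Poly_Mapping.lookup c \<sigma> * Poly_Mapping.lookup d \<sigma>)"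
  unfolding chain_inner_def using assms
  by (intro sum.mono_neutral_left) (auto simp: in_keys_iff)

lemma chain_inner_commute: "chain_inner c d = chain_inner d c"
proof -
  let ?S = "Poly_Mapping.keys c \<union> Poly_Mapping.keys d"
  have "chain_inner c d = (\<Sum>\<sigma>\<in>?S. Poly_Mapping.lookup c \<sigma> * Poly_Mapping.lookup d \<sigma>)"
    "chain_inner d c = (\<Sum>\<sigma>\<in>?S. Poly_Mapping.lookup d \<sigma> * Poly_Mapping.lookup c \<sigma>)"
    by (rule chain_inner_superset; simp)+
  then show ?thesis by (simp add: mult.commute)
qed

lemma linear_chain_inner_right: "linear (chain_inner c)"
  unfolding chain_inner_def
  by (rule linearI)
    (simp_all add: lookup_add algebra_simps sum.distrib sum_distrib_left)

lemma linear_chain_inner_left: "linear (\<lambda>c. chain_inner c d)"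
  using linear_chain_inner_right[of d] by (simp add: chain_inner_commute[of _ d])

lemmas chain_inner_simps =
  linear_add[OF linear_chain_inner_right] linear_diff[OF linear_chain_inner_right]
  linear_scale[OF linear_chain_inner_right] linear_0[OF linear_chain_inner_right]
  linear_add[OF linear_chain_inner_left] linear_diff[OF linear_chain_inner_left]
  linear_scale[OF linear_chain_inner_left] linear_0[OF linear_chain_inner_left]

lemma chain_inner_self_nonneg: "chain_inner c c \<ge> 0"
  unfolding chain_inner_def by (intro sum_nonneg) simp

lemma chain_inner_self_eq_0_iff: "chain_inner c c = 0 \<longleftrightarrow> c = 0"
proof
  assume "chain_inner c c = 0"
  then have "\<forall>\<sigma>\<in>Poly_Mapping.keys c. Poly_Mapping.lookup c \<sigma> * Poly_Mapping.lookup c \<sigma> = 0"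
    unfolding chain_inner_def by (subst (asm) sum_nonneg_eq_0_iff) auto
  then show "c = 0" by (auto simp: in_keys_iff intro!: poly_mapping_eqI)
qed (simp add: chain_inner_def)

text \<open>Nondegeneracy, by testing with \<open>z = x - y\<close>. It makes adjoints unique and
  forces the Riesz vector of a zero functional to vanish.\<close>

lemma chain_inner_ext:
  assumes "subspace S" "x \<in> S" "y \<in> S" "\<And>z. z \<in> S \<Longrightarrow> chain_inner z x = chain_inner z y"
  shows "x = y"
proof -
  have "chain_inner (x - y) (x - y) = 0"
    using assms(4)[of "x - y"] assms(1-3) by (simp add: subspace_diff chain_inner_simps)
  then show ?thesis by (simp add: chain_inner_self_eq_0_iff)
qed

text \<open>Riesz representation by induction on the spanning set, with one Gram-Schmidt step for
  each new vector.\<close>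

lemma chain_inner_riesz_span:
  assumes "finite B" "linear f"
  shows "\<exists>t\<in>span B. \<forall>z\<in>span B. f z = chain_inner z t"
  using assms
proof (induction B arbitrary: f rule: finite_induct)
  case empty
  then show ?case by (auto simp: linear_0 chain_inner_simps)
next
  case (insert b B)
  \<comment> \<open>The induction hypothesis for the pairing with \<open>b\<close> gives the
    orthogonal projection \<open>p\<close> of \<open>b\<close> onto the old span.\<close>
  obtain p where p: "p \<in> span B" "\<And>z. z \<in> span B \<Longrightarrow> chain_inner z b = chain_inner z p"
    using insert.IH[OF linear_chain_inner_left[of b]] by blast
  obtain t where t: "t \<in> span B" "\<And>z. z \<in> span B \<Longrightarrow> f z = chain_inner z t"
    using insert.IH[OF insert.prems] by blast
  define e where "e = b - p"
  have e_orth: "chain_inner z e = 0" if "z \<in> span B" for z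
    using p(2)[OF that] by (simp add: e_def chain_inner_simps)
  have f: "linear f" by (rule insert.prems)
  show ?case
  proof (cases "e = 0")
    case True
    then have "span (insert b B) = span B"
      using p(1) by (simp add: e_def span_redundant)
    then show ?thesis using t by auto
  next
    case False
    then have ee: "chain_inner e e \<noteq> 0" by (simp add: chain_inner_self_eq_0_iff)
    \<comment> \<open>The coefficient of \<open>e\<close> is chosen to get
      \<open>chain_inner e s = f e\<close>; as \<open>e\<close> is orthogonal to
      \<open>span B\<close>, the values on \<open>span B\<close> do not change.\<close>
    define s where "s = t + ((f e - chain_inner e t) / chain_inner e e) *\<^sub>R e"
    have B: "span B \<subseteq> span (insert b B)" by (intro span_mono) auto
    have "e \<in> span (insert b B)"
      unfolding e_def using p(1) B by (intro span_diff) (auto intro: span_base)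
    then have "s \<in> span (insert b B)"
      unfolding s_def using t(1) B by (intro span_add span_scale) auto
    moreover have "f z = chain_inner z s" if z: "z \<in> span (insert b B)" for z
    proof -
      obtain k where k: "z - k *\<^sub>R b \<in> span B" using z by (auto simp: span_insert)
      define y where "y = (z - k *\<^sub>R b) + k *\<^sub>R p"
      have y: "y \<in> span B" unfolding y_def using k p(1) by (intro span_add span_scale)
      have z_eq: "z = y + k *\<^sub>R e" by (simp add: y_def e_def algebra_simps)
      have "chain_inner e s = f e"
        using ee by (simp add: s_def chain_inner_simps)
      moreover have "chain_inner y s = f y"
        using t(2)[OF y] e_orth[OF y] by (simp add: s_def chain_inner_simps)
      ultimately show ?thesis
        by (simp add: z_eq chain_inner_simps linear_add[OF f] linear_scale[OF f])
    qed
    ultimately show ?thesis by blast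
  qed
qed

section \<open>Chains supported on a given set of simplices\<close>

definition chains_on :: "'a set set \<Rightarrow> 'a chain set" where
  "chains_on S = {c. Poly_Mapping.keys c \<subseteq> S}"

lemma mem_chains_on_iff: "c \<in> chains_on S \<longleftrightarrow> (\<forall>\<sigma>. \<sigma> \<notin> S \<longrightarrow> Poly_Mapping.lookup c \<sigma> = 0)"
  unfolding chains_on_def by (auto simp: in_keys_iff)

lemma subspace_chains_on: "subspace (chains_on S)"
  by (auto simp: subspace_def mem_chains_on_iff lookup_add)

lemma chains_on_mono: "S \<subseteq> T \<Longrightarrow> chains_on S \<subseteq> chains_on T"
  unfolding chains_on_def by auto

lemma chain_eq_sum_single:
  assumes "finite S" "Poly_Mapping.keys c \<subseteq> S"
  shows "c = (\<Sum>\<sigma>\<in>S. Poly_Mapping.single \<sigma> (Poly_Mapping.lookup c \<sigma>))"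
  using assms by (intro poly_mapping_eqI)
    (auto simp: lookup_sum lookup_single when_def in_keys_iff)

text \<open>Chains on the finite set \<open>F\<close> are spanned by its simplices, so a basis of
  \<open>S\<close> is finite and \<open>chain_inner_riesz_span\<close> applies.\<close>

lemma chain_inner_riesz:
  assumes S: "subspace S" "S \<subseteq> chains_on F" "finite F" and f: "linear f"
  shows "\<exists>t\<in>S. \<forall>z\<in>S. f z = chain_inner z t"
proof -
  obtain B where B: "B \<subseteq> S" "independent B" "S \<subseteq> span B"
    using maximal_independent_subset by blast
  let ?E = "(\<lambda>\<sigma>. Poly_Mapping.single \<sigma> (1::real)) ` F"
  have "c \<in> span ?E" if "c \<in> chains_on F" for c
  proof -
    have "c = (\<Sum>\<sigma>\<in>F. Poly_Mapping.single \<sigma> (Poly_Mapping.lookup c \<sigma>))"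
      using that S(3) by (intro chain_eq_sum_single) (auto simp: chains_on_def)
    also have "\<dots> = (\<Sum>\<sigma>\<in>F. Poly_Mapping.lookup c \<sigma> *\<^sub>R Poly_Mapping.single \<sigma> (1::real))"
      by (intro sum.cong poly_mapping_eqI) (auto simp: lookup_single when_def)
    also have "\<dots> \<in> span ?E" by (intro span_sum span_scale span_base) auto
    finally show ?thesis .
  qed
  then have "finite B"
    using independent_span_bound[of ?E B] B(1,2) S(2,3) by blast
  moreover have "span B = S" using B S(1) by (simp add: span_subspace)
  ultimately show ?thesis using chain_inner_riesz_span[OF _ f, of B] by simp
qed

text \<open>Coordinate projection onto the chains on \<open>S\<close>. With the simplices containing
  \<open>v\<close> it selects the representative of a relative chain; with \<open>K i\<close> it
  yields the pseudoinverse of the inclusion.\<close>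

lift_definition restrict_chain :: "'a set set \<Rightarrow> 'a chain \<Rightarrow> 'a chain"
  is "\<lambda>S c \<sigma>. if \<sigma> \<in> S then c \<sigma> else 0"
  by (rule finite_subset) auto

lemma lookup_restrict_chain [simp]:
  "Poly_Mapping.lookup (restrict_chain S c) \<sigma> = (if \<sigma> \<in> S then Poly_Mapping.lookup c \<sigma> else 0)"
  by transfer simp

lemma linear_restrict_chain: "linear (restrict_chain S)"
  by (rule linearI) (auto intro!: poly_mapping_eqI simp: lookup_add)

lemma restrict_chain_id: "c \<in> chains_on S \<Longrightarrow> restrict_chain S c = c"
  by (auto simp: mem_chains_on_iff intro!: poly_mapping_eqI)

text \<open>A coordinate projection is self-adjoint, which supplies the symmetry required in the
  Penrose conditions.\<close>

lemma chain_inner_restrict_chain: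
  "chain_inner (restrict_chain S c) d = chain_inner c (restrict_chain S d)"
proof -
  have "Poly_Mapping.keys (restrict_chain S c) \<subseteq> Poly_Mapping.keys c"
    by (auto simp: in_keys_iff split: if_splits)
  then show ?thesis
    by (subst (1 2) chain_inner_superset[of "Poly_Mapping.keys c"]) (auto intro: sum.cong)
qed

lemma chain_inner_orthogonal:
  assumes "c \<in> chains_on S" "d \<in> chains_on T" "S \<inter> T = {}"
  shows "chain_inner c d = 0"
  unfolding chain_inner_def using assms
  by (intro sum.neutral ballI) (auto simp: chains_on_def not_in_keys_iff_lookup_eq_zero[symmetric])

lemma chains_on_disjoint:
  assumes "c \<in> chains_on S" "c \<in> chains_on T" "S \<inter> T = {}"
  shows "c = 0"
  using chain_inner_orthogonal[OF assms] by (simp add: chain_inner_self_eq_0_iff)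

section \<open>The boundary operator\<close>

lemma boundary_superset:
  fixes c :: "'a::linorder chain"
  assumes "n \<noteq> 0" "finite S" "Poly_Mapping.keys c \<subseteq> S"
  shows "boundary n c =
    (\<Sum>\<sigma>\<in>S. \<Sum>w\<in>\<sigma>. Poly_Mapping.single (\<sigma> - {w})
       ((-1) ^ card {u \<in> \<sigma>. u < w} * Poly_Mapping.lookup c \<sigma>))"
  using assms unfolding boundary_def
  by (auto intro!: sum.mono_neutral_left simp: in_keys_iff)

lemma linear_boundary: "linear (boundary n :: 'a::linorder chain \<Rightarrow> 'a chain)"
proof (cases "n = 0")
  case True
  then have "boundary n = (\<lambda>c :: 'a chain. 0)" by (auto simp: boundary_def)
  then show ?thesis by (simp add: linear_iff)
next
  case False
  show ?thesis
  proof (rule linearI)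
    fix c d :: "'a chain"
    let ?S = "Poly_Mapping.keys c \<union> Poly_Mapping.keys d"
    show "boundary n (c + d) = boundary n c + boundary n d"
      using keys_add[of c d] False
      by (simp add: boundary_superset[of n ?S] lookup_add distrib_left single_add sum.distrib)
  next
    fix a and c :: "'a chain"
    have sc: "Poly_Mapping.single \<tau> (x * (a * y)) = a *\<^sub>R Poly_Mapping.single \<tau> (x * y)"
      for \<tau> :: "'a set" and x y
      by (rule poly_mapping_eqI) (simp add: lookup_single when_def)
    have "Poly_Mapping.keys (a *\<^sub>R c) \<subseteq> Poly_Mapping.keys c"
      by (auto simp: in_keys_iff)
    then show "boundary n (a *\<^sub>R c) = a *\<^sub>R boundary n c"
      using False
      by (simp add: boundary_superset[of n "Poly_Mapping.keys c"] sc scaleR_sum_right)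
  qed
qed

lemma boundary_single:
  fixes \<sigma> :: "'a::linorder set"
  assumes "n \<noteq> 0"
  shows "boundary n (Poly_Mapping.single \<sigma> a) =
    (\<Sum>w\<in>\<sigma>. Poly_Mapping.single (\<sigma> - {w}) ((-1) ^ card {u \<in> \<sigma>. u < w} * a))"
  using assms by (subst boundary_superset[of n "{\<sigma>}"]) auto

text \<open>The guard \<open>n \<noteq> 0\<close> keeps the face condition satisfiable for complexes
  in degree 0, where the face of a vertex would be the empty set, which is no simplex.\<close>

lemma boundary_mem_chains_on:
  assumes "c \<in> chains_on S" "\<And>\<sigma> w. n \<noteq> 0 \<Longrightarrow> \<sigma> \<in> S \<Longrightarrow> w \<in> \<sigma> \<Longrightarrow> \<sigma> - {w} \<in> T"
  shows "boundary n c \<in> chains_on T"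
  unfolding boundary_def using assms
  by (auto intro!: subspace_sum subspace_chains_on simp: subspace_0[OF subspace_chains_on])
     (auto simp: chains_on_def)

text \<open>Removing two vertices in either order leaves the same face with opposite signs. The
  double sum is antisymmetric, hence equal to its own negative.\<close>

lemma boundary_boundary_single:
  fixes \<sigma> :: "'a::linorder set"
  assumes n: "n \<noteq> 0"
  shows "boundary n (boundary (Suc n) (Poly_Mapping.single \<sigma> a)) = 0"
proof (cases "finite \<sigma>")
  \<comment> \<open>A sum over an infinite set is 0 by convention, so already the inner boundary
    vanishes.\<close>
  case False
  then show ?thesis by (simp add: boundary_single linear_0[OF linear_boundary])
next
  case fin: True
  define s where "s \<tau> w = (-1 :: real) ^ card {u \<in> \<tau>. u < w}" for \<tau> :: "'a set" and w
  \<comment> \<open>The diagonal is set to 0 so that the inner sum can run over all of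
    \<open>\<sigma>\<close> and the two sums can be swapped.\<close>
  define G where "G w u = (if u = w then 0
    else Poly_Mapping.single (\<sigma> - {w, u}) (s (\<sigma> - {w}) u * (s \<sigma> w * a)))" for w u
  \<comment> \<open>Omitting the larger vertex \<open>w\<close> keeps the position of
    \<open>u\<close>; omitting the smaller vertex \<open>u\<close> lowers the position of
    \<open>w\<close> by one.\<close>
  have s_less: "s (\<sigma> - {w}) u = s \<sigma> u" "s (\<sigma> - {u}) w = - s \<sigma> w"
    if "u < w" "u \<in> \<sigma>" for u w
  proof -
    have "{x \<in> \<sigma> - {w}. x < u} = {x \<in> \<sigma>. x < u}" using that by auto
    then show "s (\<sigma> - {w}) u = s \<sigma> u" by (simp add: s_def)
    have "{x \<in> \<sigma>. x < w} = insert u {x \<in> \<sigma> - {u}. x < w}" using that by auto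
    then show "s (\<sigma> - {u}) w = - s \<sigma> w" using fin by (simp add: s_def)
  qed
  have anti_less: "G w u = - G u w" if "u < w" "u \<in> \<sigma>" for u w
  proof -
    have "G w u = Poly_Mapping.single (\<sigma> - {w, u}) (s \<sigma> u * (s \<sigma> w * a))"
      using that by (auto simp: G_def s_less(1))
    moreover have "G u w = Poly_Mapping.single (\<sigma> - {w, u}) (- (s \<sigma> u * (s \<sigma> w * a)))"
      using that by (auto simp add: G_def s_less(2) insert_commute[of u w] mult.left_commute)
    ultimately show ?thesis by (simp add: single_uminus)
  qed
  have anti: "G w u = - G u w" if "w \<in> \<sigma>" "u \<in> \<sigma>" for u w
  proof (cases u w rule: linorder_cases)
    case less
    then show ?thesis using anti_less that by blast
  next
    case equal
    then show ?thesis by (simp add: G_def)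
  next
    case greater
    then have "G u w = - G w u" using anti_less that by blast
    then show ?thesis by simp
  qed
  have "boundary n (boundary (Suc n) (Poly_Mapping.single \<sigma> a)) =
      (\<Sum>w\<in>\<sigma>. \<Sum>u\<in>\<sigma> - {w}. G w u)"
    using n by (auto simp: boundary_single linear_sum[OF linear_boundary] G_def s_def
        intro!: sum.cong arg_cong2[where f = Poly_Mapping.single])
  also have "\<dots> = (\<Sum>w\<in>\<sigma>. \<Sum>u\<in>\<sigma>. G w u)"
    using fin by (intro sum.cong sum.mono_neutral_left) (auto simp: G_def)
  finally have eq: "boundary n (boundary (Suc n) (Poly_Mapping.single \<sigma> a)) = (\<Sum>w\<in>\<sigma>. \<Sum>u\<in>\<sigma>. G w u)" .
  have "(\<Sum>w\<in>\<sigma>. \<Sum>u\<in>\<sigma>. G w u) = (\<Sum>w\<in>\<sigma>. \<Sum>u\<in>\<sigma>. - G u w)"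
    by (intro sum.cong refl anti)
  also have "\<dots> = - (\<Sum>w\<in>\<sigma>. \<Sum>u\<in>\<sigma>. G w u)"
    by (subst sum.swap) (simp add: sum_negf)
  finally have "(2::real) *\<^sub>R (\<Sum>w\<in>\<sigma>. \<Sum>u\<in>\<sigma>. G w u) = 0"
    by (simp only: scaleR_2 eq_neg_iff_add_eq_0)
  then show ?thesis by (simp add: eq)
qed

lemma boundary_boundary:
  fixes c :: "'a::linorder chain"
  assumes "n \<noteq> 0"
  shows "boundary n (boundary (Suc n) c) = 0"
  by (subst chain_eq_sum_single[OF finite_keys order_refl, of c])
    (simp add: linear_sum[OF linear_boundary] boundary_boundary_single assms)

text \<open>The relative boundary on representatives: faces without \<open>v\<close> are zero in the
  quotient, so they are dropped. The formula does not mention the stage of the filtration.\<close>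

definition star_boundary :: "'a::linorder \<Rightarrow> nat \<Rightarrow> 'a chain \<Rightarrow> 'a chain" where
  "star_boundary v n c = restrict_chain {\<sigma>. v \<in> \<sigma>} (boundary n c)"

lemma linear_star_boundary: "linear (star_boundary v n)"
  using linear_compose[OF linear_boundary linear_restrict_chain]
  by (simp add: star_boundary_def[abs_def] comp_def)

lemma star_boundary_0 [simp]: "star_boundary v 0 c = 0"
  by (simp add: star_boundary_def boundary_def linear_0[OF linear_restrict_chain])

text \<open>The terms dropped by the inner restriction avoid \<open>v\<close>, and so do their
  faces, which the outer restriction kills. The claim thus reduces to
  \<open>boundary_boundary\<close>.\<close>

lemma star_boundary_star_boundary: "star_boundary v n (star_boundary v (Suc n) c) = 0"
proof (cases "n = 0")
  case False
  let ?S = "{\<sigma>. v \<in> \<sigma>}" and ?d = "boundary (Suc n) c"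
  have "?d - restrict_chain ?S ?d \<in> chains_on {\<sigma>. v \<notin> \<sigma>}"
    by (auto simp: mem_chains_on_iff lookup_minus)
  then have "boundary n (?d - restrict_chain ?S ?d) \<in> chains_on {\<sigma>. v \<notin> \<sigma>}"
    by (rule boundary_mem_chains_on) auto
  then have "restrict_chain ?S (boundary n (?d - restrict_chain ?S ?d)) = 0"
    by (auto simp: mem_chains_on_iff intro!: poly_mapping_eqI)
  then show ?thesis
    using False by (simp add: star_boundary_def linear_diff[OF linear_boundary]
        linear_diff[OF linear_restrict_chain] boundary_boundary linear_0[OF linear_restrict_chain]
        linear_neg[OF linear_boundary] linear_neg[OF linear_restrict_chain])
qed simp

section \<open>Local chains\<close>

text \<open>Chains on the open star of \<open>v\<close>, the canonical representatives of relative
  chains.\<close>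

definition star_chains :: "(int \<Rightarrow> 'a set set) \<Rightarrow> 'a \<Rightarrow> int \<Rightarrow> nat \<Rightarrow> 'a chain set" where
  "star_chains K v i n = chains_on {\<sigma> \<in> simplices (K i) n. v \<in> \<sigma>}"

text \<open>The quotient map onto the relative chains. It is used on all chains of
  \<open>K i\<close>, since the boundary of a star chain can have terms avoiding
  \<open>v\<close>.\<close>

definition local_class ::
  "(int \<Rightarrow> 'a set set) \<Rightarrow> 'a \<Rightarrow> int \<Rightarrow> nat \<Rightarrow> 'a chain \<Rightarrow> 'a chain set" where
  "local_class K v i n = coset (chain_space (K i) n) (chains_on (simplices (avoiding K v i) n))"

lemma subspace_star_chains: "subspace (star_chains K v i n)"
  unfolding star_chains_def by (rule subspace_chains_on)

lemma star_chains_subset: "star_chains K v i n \<subseteq> chains_on (simplices (K i) n)"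
  unfolding star_chains_def by (intro chains_on_mono) auto

lemma simplices_avoiding_subset: "simplices (avoiding K v i) n \<subseteq> simplices (K i) n"
  by (auto simp: simplices_def avoiding_def)

lemma vcarrier_chain_space: "vcarrier (chain_space K n) = chains_on (simplices K n)"
  by (simp add: chain_space_def chains_on_def)

lemma presents_chain_space:
  "presents (chain_space K n) (\<lambda>c. c) (chains_on (simplices K n)) {0}"
  unfolding presents_def vcarrier_chain_space
  by (simp add: subspace_chains_on subspace_0 chain_space_def)

text \<open>\<open>presents\<close> reads only the vector space fields, which
  \<open>quotient_ipspace\<close> copies from \<open>quotient_space\<close>.\<close>

lemma presents_quotient_ipspace:
  "presents (quotient_ipspace V W) q R N \<longleftrightarrow> presents (quotient_space V W) q R N"
  by (simp add: presents_def quotient_ipspace_def quotient_space_def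
      rvspace.extend_def ipspace.fields_def)

lemma presents_local_chains_full:
  "presents (local_chains K v i n) (local_class K v i n)
     (chains_on (simplices (K i) n)) (chains_on (simplices (avoiding K v i) n))"
  using presents_quotient[OF presents_chain_space subspace_chains_on _
      chains_on_mono[OF simplices_avoiding_subset]]
  by (simp add: local_chains_def rel_chain_space_def presents_quotient_ipspace
      vcarrier_chain_space local_class_def[abs_def] subspace_0 subspace_chains_on)

text \<open>Each chain splits into its terms with \<open>v\<close> and its terms without
  \<open>v\<close>, so the star chains complement the subspace divided out.\<close>

lemma presents_local_chains:
  "presents (local_chains K v i n) (local_class K v i n) (star_chains K v i n) {0}"
proof (rule presents_complement[OF presents_local_chains_full])
  have "simplices (avoiding K v i) n \<inter> {\<sigma> \<in> simplices (K i) n. v \<in> \<sigma>} = {}"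
    by (auto simp: simplices_def avoiding_def)
  then show "chains_on (simplices (avoiding K v i) n) \<inter> star_chains K v i n \<subseteq> {0}"
    unfolding star_chains_def using chains_on_disjoint by blast
next
  fix c assume c: "c \<in> chains_on (simplices (K i) n)"
  let ?s = "restrict_chain {\<sigma>. v \<in> \<sigma>} c"
  have "?s \<in> star_chains K v i n" "c - ?s \<in> chains_on (simplices (avoiding K v i) n)"
    using c by (auto simp: star_chains_def mem_chains_on_iff simplices_def avoiding_def lookup_minus)
  then show "\<exists>s\<in>star_chains K v i n. c - s \<in> chains_on (simplices (avoiding K v i) n)" by blast
qed (rule subspace_star_chains star_chains_subset)+

text \<open>Pairing with single simplices that avoid \<open>v\<close> shows that an orthogonal chain
  has no such terms.\<close>

lemma orthogonal_to_avoiding: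
  "orthogonal_to (chain_space (K i) n) (chains_on (simplices (avoiding K v i) n)) =
     star_chains K v i n"
proof (intro equalityI subsetI)
  fix c assume c: "c \<in> orthogonal_to (chain_space (K i) n) (chains_on (simplices (avoiding K v i) n))"
  have "Poly_Mapping.lookup c \<sigma> = 0" if "\<sigma> \<in> simplices (avoiding K v i) n" for \<sigma>
  proof -
    have "Poly_Mapping.single \<sigma> 1 \<in> chains_on (simplices (avoiding K v i) n)"
      using that by (simp add: chains_on_def)
    then have "chain_inner c (Poly_Mapping.single \<sigma> 1) = 0"
      using c by (simp add: orthogonal_to_def chain_space_def)
    then have "chain_inner (Poly_Mapping.single \<sigma> 1) c = 0"
      by (simp only: chain_inner_commute)
    then show ?thesis by (simp add: chain_inner_def)
  qed
  then show "c \<in> star_chains K v i n"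
    using c by (auto simp: orthogonal_to_def vcarrier_chain_space star_chains_def mem_chains_on_iff
        simplices_def avoiding_def)
next
  fix c assume c: "c \<in> star_chains K v i n"
  then have "chain_inner c w = 0" if "w \<in> chains_on (simplices (avoiding K v i) n)" for w
    unfolding star_chains_def using that
    by (rule chain_inner_orthogonal) (auto simp: simplices_def avoiding_def)
  then show "c \<in> orthogonal_to (chain_space (K i) n) (chains_on (simplices (avoiding K v i) n))"
    using c star_chains_subset[of K v i n]
    by (auto simp: orthogonal_to_def vcarrier_chain_space) (auto simp: chain_space_def)
qed

text \<open>Two star chains in one coset differ by a chain supported both on simplices with
  \<open>v\<close> and on simplices without \<open>v\<close>, hence by 0. This leaves one candidate
  for the description in \<open>quotient_inner\<close>.\<close>

lemma local_class_Int_star_chains: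
  assumes x: "x \<in> star_chains K v i n"
  shows "local_class K v i n x \<inter> star_chains K v i n = {x}"
proof -
  have "local_class K v i n x = (+) x ` chains_on (simplices (avoiding K v i) n)"
    by (simp add: local_class_def coset_def chain_space_def)
  moreover have "c = 0" if "c \<in> chains_on (simplices (avoiding K v i) n)" "x + c \<in> star_chains K v i n" for c
  proof -
    have "c \<in> star_chains K v i n"
      using subspace_diff[OF subspace_star_chains that(2) x] by simp
    with that(1) show ?thesis
      unfolding star_chains_def by (rule chains_on_disjoint) (auto simp: simplices_def avoiding_def)
  qed
  ultimately show ?thesis using x by (auto simp: subspace_0 subspace_chains_on image_iff)
qed

lemma local_chains_inner:
  assumes "x \<in> star_chains K v i n" "y \<in> star_chains K v i n"
  shows "vinner (local_chains K v i n) (local_class K v i n x) (local_class K v i n y) =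
    chain_inner x y"
proof -
  have "vinner (local_chains K v i n) =
      quotient_inner (chain_space (K i) n) (chains_on (simplices (avoiding K v i) n))"
    by (simp add: local_chains_def rel_chain_space_def quotient_ipspace_def
        rvspace.extend_def ipspace.fields_def vcarrier_chain_space)
  then show ?thesis
    by (simp add: quotient_inner_def orthogonal_to_avoiding local_class_Int_star_chains assms)
      (simp add: chain_space_def)
qed

section \<open>Boundary and inclusion maps on star representatives\<close>

lemma face_mem_simplices:
  assumes "finite_simplicial_complex L" "\<sigma> \<in> simplices L n" "w \<in> \<sigma>" "n \<noteq> 0"
  shows "\<sigma> - {w} \<in> simplices L (n - 1)"
proof -
  have c: "card (\<sigma> - {w}) = n" using assms by (simp add: simplices_def)
  then have "\<sigma> - {w} \<noteq> {}" using assms(4) by fastforce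
  then have "\<sigma> - {w} \<in> L"
    using assms(1,2) unfolding finite_simplicial_complex_def simplices_def
    by (metis (no_types, lifting) Diff_subset mem_Collect_eq)
  then show ?thesis using c assms(4) by (simp add: simplices_def)
qed

lemma boundary_simplices:
  assumes "finite_simplicial_complex L"
  shows "boundary n ` chains_on (simplices L n) \<subseteq> chains_on (simplices L (n - 1))"
proof (rule image_subsetI)
  fix c assume "c \<in> chains_on (simplices L n)"
  then show "boundary n c \<in> chains_on (simplices L (n - 1))"
    by (rule boundary_mem_chains_on) (rule face_mem_simplices[OF assms])
qed

lemma finite_simplicial_complex_avoiding:
  assumes "finite_simplicial_complex (K i)"
  shows "finite_simplicial_complex (avoiding K v i)"
proof -
  have "\<tau> \<in> avoiding K v i" if "\<sigma> \<in> avoiding K v i" "\<tau> \<noteq> {}" "\<tau> \<subseteq> \<sigma>" for \<sigma> \<tau>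
    using assms that unfolding finite_simplicial_complex_def avoiding_def by blast
  moreover have "finite (avoiding K v i)" "\<forall>\<sigma>\<in>avoiding K v i. finite \<sigma> \<and> \<sigma> \<noteq> {}"
    using assms by (simp_all add: finite_simplicial_complex_def avoiding_def)
  ultimately show ?thesis unfolding finite_simplicial_complex_def by blast
qed

text \<open>In degree 0 the truncated \<open>n - 1\<close> is again 0, and the value is the zero
  chain.\<close>

lemma star_boundary_mem:
  assumes "finite_simplicial_complex (K i)" "x \<in> star_chains K v i n"
  shows "star_boundary v n x \<in> star_chains K v i (n - 1)"
proof -
  have "boundary n x \<in> chains_on (simplices (K i) (n - 1))"
    using boundary_simplices[OF assms(1)] assms(2) star_chains_subset[of K v i n] by blast
  then show ?thesis
    by (auto simp: star_boundary_def star_chains_def mem_chains_on_iff)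
qed

lemma local_class_restrict:
  assumes "c \<in> chains_on (simplices (K i) n)"
  shows "local_class K v i n (restrict_chain {\<sigma>. v \<in> \<sigma>} c) = local_class K v i n c"
proof (rule presentsD(6)[OF presents_local_chains_full, THEN iffD2])
  show "restrict_chain {\<sigma>. v \<in> \<sigma>} c - c \<in> chains_on (simplices (avoiding K v i) n)"
    "restrict_chain {\<sigma>. v \<in> \<sigma>} c \<in> chains_on (simplices (K i) n)"
    using assms by (auto simp: mem_chains_on_iff simplices_def avoiding_def lookup_minus)
qed fact

text \<open>The quotient map is first computed with the full boundary, whose terms without
  \<open>v\<close> then disappear by \<open>local_class_restrict\<close>.\<close>

lemma local_boundary_class:
  assumes K: "finite_simplicial_complex (K i)" and x: "x \<in> star_chains K v i n"
  shows "local_boundary K v i n (local_class K v i n x) =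
    local_class K v i (n - 1) (star_boundary v n x)"
proof -
  have x': "x \<in> chains_on (simplices (K i) n)" using x star_chains_subset[of K v i n] by blast
  have "local_boundary K v i n (local_class K v i n x) = local_class K v i (n - 1) (boundary n x)"
    using presents_quotient_map[where g = "boundary n" and F = "boundary n", OF
        presents_chain_space[of "K i" n] subspace_chains_on[of "simplices (avoiding K v i) n"] _ _
        presents_chain_space[of "K i" "n - 1"] subspace_chains_on[of "simplices (avoiding K v i) (n - 1)"]
        _ _ _ linear_boundary boundary_simplices[OF K]
        boundary_simplices[OF finite_simplicial_complex_avoiding[of K i v, OF K]] x']
    by (simp add: local_boundary_def rel_boundary_def local_class_def vcarrier_chain_space
        chains_on_mono simplices_avoiding_subset subspace_0 subspace_chains_on)
  moreover have "boundary n x \<in> chains_on (simplices (K i) (n - 1))"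
    using boundary_simplices[OF K] x' by blast
  ultimately show ?thesis by (simp add: star_boundary_def local_class_restrict)
qed

lemma local_incl_class:
  assumes "K i \<subseteq> K j" and x: "x \<in> chains_on (simplices (K i) n)"
  shows "local_incl K v j n (local_class K v i n x) = local_class K v j n x"
proof -
  have "simplices (K i) n \<subseteq> simplices (K j) n"
    "simplices (avoiding K v i) n \<subseteq> simplices (avoiding K v j) n"
    using assms(1) by (auto simp: simplices_def avoiding_def)
  then show ?thesis
    using presents_quotient_map[where g = "\<lambda>c. c" and F = "\<lambda>c. c", OF
        presents_chain_space[of "K i" n] subspace_chains_on[of "simplices (avoiding K v i) n"] _ _
        presents_chain_space[of "K j" n] subspace_chains_on[of "simplices (avoiding K v j) n"]
        _ _ _ linear_ident _ _ x]
    by (simp add: local_incl_def rel_chain_incl_def local_class_def vcarrier_chain_space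
        chains_on_mono simplices_avoiding_subset subspace_0 subspace_chains_on)
qed

section \<open>The persistent local Laplacian\<close>

lemma star_chains_riesz:
  assumes "finite_simplicial_complex (K i)" "subspace S" "S \<subseteq> star_chains K v i n" "linear f"
  shows "\<exists>t\<in>S. \<forall>z\<in>S. f z = chain_inner z t"
proof (rule chain_inner_riesz[OF assms(2)])
  show "S \<subseteq> chains_on {\<sigma> \<in> simplices (K i) n. v \<in> \<sigma>}"
    using assms(3) by (simp add: star_chains_def)
  show "finite {\<sigma> \<in> simplices (K i) n. v \<in> \<sigma>}"
    using assms(1) by (simp add: finite_simplicial_complex_def simplices_def)
qed fact

lemma star_chains_mono: "K i \<subseteq> K j \<Longrightarrow> star_chains K v i n \<subseteq> star_chains K v j n"
  unfolding star_chains_def by (intro chains_on_mono) (auto simp: simplices_def)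

lemma local_class_eq_iff:
  assumes "x \<in> star_chains K v i n" "y \<in> star_chains K v i n"
  shows "local_class K v i n x = local_class K v i n y \<longleftrightarrow> x = y"
  using presentsD(6)[OF presents_local_chains assms] by simp

text \<open>As \<open>q\<close> and \<open>r\<close> are isometric on representatives,
  \<open>adj\<close> says that \<open>q t\<close> satisfies the equation of the adjoint; uniqueness
  for the description comes from \<open>chain_inner_ext\<close>.\<close>

lemma adjoint_map_presents:
  assumes p: "presents V q S {0}"
    and V: "\<And>x y. x \<in> S \<Longrightarrow> y \<in> S \<Longrightarrow> vinner V (q x) (q y) = chain_inner x y"
    and W: "\<And>x y. x \<in> T \<Longrightarrow> y \<in> T \<Longrightarrow> vinner W (r x) (r y) = chain_inner x y"
    and f: "\<And>z. z \<in> S \<Longrightarrow> f (q z) = r (g z)" "\<And>z. z \<in> S \<Longrightarrow> g z \<in> T"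
    and x: "x \<in> T" and t: "t \<in> S" and adj: "\<And>z. z \<in> S \<Longrightarrow> chain_inner (g z) x = chain_inner z t"
  shows "adjoint_map V W f (r x) = q t"
  unfolding adjoint_map_def
proof (rule the_equality)
  show "q t \<in> vcarrier V \<and> (\<forall>z\<in>vcarrier V. vinner W (f z) (r x) = vinner V z (q t))"
    using t x by (auto simp: presentsD(4)[OF p] V W f adj)
  fix X assume X: "X \<in> vcarrier V \<and> (\<forall>z\<in>vcarrier V. vinner W (f z) (r x) = vinner V z X)"
  then obtain s where s: "s \<in> S" "X = q s" by (auto simp: presentsD(4)[OF p])
  have "s = t"
  proof (rule chain_inner_ext[OF presentsD(1)[OF p] s(1) t])
    fix z assume z: "z \<in> S"
    have "vinner W (f (q z)) (r x) = vinner V (q z) (q s)"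
      using X z s by (auto simp: presentsD(4)[OF p])
    then show "chain_inner z s = chain_inner z t"
      using z s(1) x by (simp add: V W f adj)
  qed
  then show "X = q t" using s by simp
qed

text \<open>The coordinate projection satisfies the Penrose conditions, so the choice in
  \<open>pseudoinverse\<close> has a witness. On the image of the injective inclusion, the value of
  any witness is determined by \<open>f (g (f x)) = f x\<close>.\<close>

lemma pseudoinverse_local_incl:
  assumes K: "K i \<subseteq> K j" and x: "x \<in> star_chains K v i n"
  shows "pseudoinverse (local_chains K v i n) (local_chains K v j n) (local_incl K v j n)
    (local_class K v j n x) = local_class K v i n x"
proof -
  let ?V = "local_chains K v i n" and ?W = "local_chains K v j n" and ?f = "local_incl K v j n"
  let ?q = "local_class K v i n" and ?r = "local_class K v j n"
  let ?R = "star_chains K v i n" and ?S = "star_chains K v j n"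
  note V = presents_local_chains[of K v i n] and W = presents_local_chains[of K v j n]
  have sub: "?R \<subseteq> ?S" by (rule star_chains_mono[of K i j v n, OF K])
  have f: "?f (?q y) = ?r y" if "y \<in> ?R" for y
    using local_incl_class[of K i j y n v, OF K] that star_chains_subset[of K v i n] by blast
  \<comment> \<open>Pass to the star representative, keep the simplices of \<open>K i\<close>, and
    return to classes of stage \<open>i\<close>.\<close>
  define g where "g Y = ?q (restrict_chain (K i) (inv_into ?S ?r Y))" for Y
  have inj: "inj_on ?r ?S" by (auto intro!: inj_onI simp: local_class_eq_iff)
  have g: "g (?r y) = ?q (restrict_chain (K i) y)" if "y \<in> ?S" for y
    using that inj by (simp add: g_def)
  have res: "restrict_chain (K i) y \<in> ?R" if "y \<in> ?S" for y
    using that by (auto simp: star_chains_def mem_chains_on_iff simplices_def)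
  have res_id: "restrict_chain (K i) y = y" if "y \<in> ?R" for y
    using that by (intro restrict_chain_id) (auto simp: star_chains_def mem_chains_on_iff simplices_def)
  have "g \<in> linear_maps ?W ?V"
    unfolding linear_maps_def presentsD(4)[OF W] presentsD(4)[OF V]
    using subspace_star_chains[of K v j n]
    by (auto simp: presentsD(7,8)[OF W] presentsD(7,8)[OF V] g res subspace_add subspace_scale
        linear_add[OF linear_restrict_chain] linear_scale[OF linear_restrict_chain])
  moreover have "self_adjoint_on ?W (\<lambda>y. ?f (g y))" "self_adjoint_on ?V (\<lambda>y. g (?f y))"
    unfolding self_adjoint_on_def presentsD(4)[OF W] presentsD(4)[OF V]
    using sub by (auto simp: f g res res_id local_chains_inner subset_iff chain_inner_restrict_chain)
  ultimately have "is_pseudoinverse ?V ?W ?f g"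
    unfolding is_pseudoinverse_def presentsD(4)[OF W] presentsD(4)[OF V]
    using sub by (auto simp: f g res res_id subset_iff)
  then have P: "is_pseudoinverse ?V ?W ?f (pseudoinverse ?V ?W ?f)"
    unfolding pseudoinverse_def by (rule someI[of "is_pseudoinverse ?V ?W ?f"])
  let ?X = "pseudoinverse ?V ?W ?f (?r x)"
  have "?r x \<in> vcarrier ?W" using x sub by (auto simp: presentsD(4)[OF W])
  then have "?X \<in> vcarrier ?V"
    using P by (simp add: is_pseudoinverse_def linear_maps_def)
  then obtain y where y: "y \<in> ?R" "?X = ?q y" by (auto simp: presentsD(4)[OF V])
  have "?f ?X = ?f (?q x)"
    using P x f[OF x] by (auto simp: is_pseudoinverse_def presentsD(4)[OF V])
  then have "?r y = ?r x" using x y f by simp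
  then show ?thesis using x y sub by (simp add: local_class_eq_iff subset_iff)
qed

definition star_theta ::
  "(int \<Rightarrow> 'a::linorder set set) \<Rightarrow> 'a \<Rightarrow> int \<Rightarrow> int \<Rightarrow> nat \<Rightarrow> 'a chain set" where
  "star_theta K v i j n =
     {z \<in> star_chains K v j (n + 1). star_boundary v (n + 1) z \<in> star_chains K v i n}"

lemma subspace_star_theta: "subspace (star_theta K v i j n)"
  unfolding star_theta_def subspace_def
  using subspace_star_chains[of K v j "n + 1"] subspace_star_chains[of K v i n]
  by (auto simp: linear_0[OF linear_star_boundary] linear_add[OF linear_star_boundary]
      linear_scale[OF linear_star_boundary] subspace_0 subspace_add subspace_scale)

text \<open>The inclusion acts as the identity on representatives, so a class lies in its image
  exactly if its representative is a star chain of stage \<open>i\<close>.\<close>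

lemma presents_theta:
  assumes K: "finite_simplicial_complex (K j)" "K i \<subseteq> K j"
  shows "presents (theta K v i j n) (local_class K v j (n + 1)) (star_theta K v i j n) {0}"
proof -
  let ?q = "local_class K v j (n + 1)"
  have incl: "local_incl K v j n ` vcarrier (local_chains K v i n) =
      local_class K v j n ` star_chains K v i n"
    unfolding presentsD(4)[OF presents_local_chains[of K v i n]] image_image
    using local_incl_class[of K i j _ n v, OF K(2)] star_chains_subset[of K v i n]
    by (intro image_cong) auto
  have "local_boundary K v j (n + 1) (?q z) \<in> local_class K v j n ` star_chains K v i n \<longleftrightarrow>
      star_boundary v (n + 1) z \<in> star_chains K v i n" if "z \<in> star_chains K v j (n + 1)" for z
    using star_boundary_mem[OF K(1) that] star_chains_mono[of K i j v n, OF K(2)]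
      local_boundary_class[of K j z v "n + 1", OF K(1) that]
    by (auto simp: local_class_eq_iff subset_iff image_iff)
  then have "{X \<in> vcarrier (local_chains K v j (n + 1)). local_boundary K v j (n + 1) X
      \<in> local_incl K v j n ` vcarrier (local_chains K v i n)} = ?q ` star_theta K v i j n"
    unfolding presentsD(4)[OF presents_local_chains[of K v j "n + 1"]] incl star_theta_def
    by blast
  moreover have "star_theta K v i j n \<subseteq> star_chains K v j (n + 1)"
    by (auto simp: star_theta_def)
  moreover have "{0} \<inter> star_theta K v i j n = {0}"
    using subspace_0[OF subspace_star_theta[of K v i j n]] by auto
  ultimately show ?thesis
    using presents_subspace_on[OF presents_local_chains[of K v j "n + 1"]
        subspace_star_theta[of K v i j n]]
    by (simp add: theta_def)
qed

text \<open>On \<open>theta\<close> the boundary already lies in the image of the inclusion, so the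
  pseudoinverse only turns a class of stage \<open>j\<close> into one of stage
  \<open>i\<close>.\<close>

lemma delta_class:
  assumes K: "finite_simplicial_complex (K j)" "K i \<subseteq> K j" and z: "z \<in> star_theta K v i j n"
  shows "delta K v i j n (local_class K v j (n + 1) z) =
    local_class K v i n (star_boundary v (n + 1) z)"
proof -
  have "local_boundary K v j (n + 1) (local_class K v j (n + 1) z) =
      local_class K v j n (star_boundary v (n + 1) z)"
    using local_boundary_class[of K j z v "n + 1", OF K(1)] z by (simp add: star_theta_def)
  then show ?thesis
    unfolding delta_def
    using pseudoinverse_local_incl[of K i j "star_boundary v (n + 1) z" v n, OF K(2)] z
    by (simp add: star_theta_def)
qed

section \<open>Cycles and harmonic chains among the star chains\<close>

definition star_cycles ::
  "(int \<Rightarrow> 'a::linorder set set) \<Rightarrow> 'a \<Rightarrow> int \<Rightarrow> nat \<Rightarrow> 'a chain set" where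
  "star_cycles K v i n = {x \<in> star_chains K v i n. star_boundary v n x = 0}"

text \<open>The quantified condition says that the adjoint of \<open>delta\<close> vanishes at
  \<open>x\<close>, written as orthogonality to the image of \<open>delta\<close>.\<close>

definition star_harmonic ::
  "(int \<Rightarrow> 'a::linorder set set) \<Rightarrow> 'a \<Rightarrow> int \<Rightarrow> int \<Rightarrow> nat \<Rightarrow> 'a chain set" where
  "star_harmonic K v i j n = {x \<in> star_cycles K v i n.
     \<forall>z\<in>star_theta K v i j n. chain_inner (star_boundary v (n + 1) z) x = 0}"

text \<open>Pairing \<open>\<Delta>x\<close> with \<open>x\<close> gives \<open>\<parallel>\<delta>\<^sup>*x\<parallel>\<^sup>2 + \<parallel>dx\<parallel>\<^sup>2\<close>.\<close>

lemma laplacian_class_eq_0_iff: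
  assumes K: "finite_simplicial_complex (K i)" "finite_simplicial_complex (K j)" "K i \<subseteq> K j"
    and x: "x \<in> star_chains K v i n"
  shows "persistent_local_laplacian K v i j n (local_class K v i n x) = vzero (local_chains K v i n)
    \<longleftrightarrow> x \<in> star_harmonic K v i j n"
proof -
  let ?D = "star_boundary v n" and ?D' = "star_boundary v (n + 1)"
  let ?T = "star_theta K v i j n" and ?A = "star_chains K v i n"
  let ?q = "local_class K v i n"
  note V = presents_local_chains[of K v i n]
  have T: "?T \<subseteq> star_chains K v j (n + 1)" by (auto simp: star_theta_def)
  \<comment> \<open>\<open>t\<close> represents the adjoint of \<open>delta\<close> at
    \<open>x\<close>: it is the Riesz vector of the functional pairing \<open>?D' z\<close> with
    \<open>x\<close>.\<close>
  obtain t where t: "t \<in> ?T" "\<And>z. z \<in> ?T \<Longrightarrow> chain_inner (?D' z) x = chain_inner z t"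
    using star_chains_riesz[of K j ?T v "n + 1", OF K(2) subspace_star_theta T
        linear_compose[OF linear_star_boundary[of v "n + 1"] linear_chain_inner_left[of x]]]
    by (auto simp: comp_def)
  \<comment> \<open>Likewise \<open>s\<close> represents the adjoint of the boundary, applied to the
    boundary of \<open>x\<close>.\<close>
  obtain s where s: "s \<in> ?A" "\<And>z. z \<in> ?A \<Longrightarrow> chain_inner (?D z) (?D x) = chain_inner z s"
    using star_chains_riesz[of K i ?A v n, OF K(1) subspace_star_chains order_refl
        linear_compose[OF linear_star_boundary[of v n] linear_chain_inner_left[of "?D x"]]]
    by (auto simp: comp_def)
  have D: "?D z \<in> star_chains K v i (n - 1)" if "z \<in> ?A" for z
    by (rule star_boundary_mem[of K i z v n, OF K(1) that])
  have Dt: "?D' t \<in> ?A" using t by (simp add: star_theta_def)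
  have "adjoint_map (theta K v i j n) (local_chains K v i n) (delta K v i j n) (?q x) =
      local_class K v j (n + 1) t"
  proof (rule adjoint_map_presents[OF presents_theta[of K j i v n, OF K(2,3)],
        where T = ?A and g = ?D'])
    show "vinner (theta K v i j n) (local_class K v j (n + 1) y) (local_class K v j (n + 1) z) =
        chain_inner y z" if "y \<in> ?T" "z \<in> ?T" for y z
      using that T local_chains_inner[of y K v j "n + 1" z]
      by (simp add: theta_def subspace_on_def subset_iff)
    show "delta K v i j n (local_class K v j (n + 1) z) = ?q (?D' z)" "?D' z \<in> ?A" if "z \<in> ?T" for z
      using that delta_class[of K j i z v n, OF K(2,3)] by (simp_all add: star_theta_def)
  qed (use t x in \<open>simp_all add: local_chains_inner\<close>)
  moreover have "adjoint_map (local_chains K v i n) (local_chains K v i (n - 1))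
      (local_boundary K v i n) (local_boundary K v i n (?q x)) = ?q s"
    unfolding local_boundary_class[of K i x v n, OF K(1) x]
    by (rule adjoint_map_presents[OF V, where T = "star_chains K v i (n - 1)" and g = ?D])
      (use s x D local_boundary_class[of K i _ v n, OF K(1)] in \<open>simp_all add: local_chains_inner\<close>)
  ultimately have "persistent_local_laplacian K v i j n (?q x) = ?q (?D' t + s)"
    unfolding persistent_local_laplacian_def
    using delta_class[of K j i t v n, OF K(2,3) t(1)] presentsD(7)[OF V Dt s(1)] by simp
  then have iff: "persistent_local_laplacian K v i j n (?q x) = vzero (local_chains K v i n) \<longleftrightarrow>
      ?D' t + s = 0"
    unfolding presentsD(5)[OF V]
    using Dt s subspace_star_chains[of K v i n]
    by (simp add: local_class_eq_iff subspace_add subspace_0)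
  have "?D' t + s = 0 \<longleftrightarrow> x \<in> star_harmonic K v i j n"
  proof
    assume "?D' t + s = 0"
    then have "chain_inner (?D' t + s) x = 0" by (simp add: chain_inner_simps)
    moreover have "chain_inner s x = chain_inner (?D x) (?D x)"
      using s(2)[OF x] by (simp add: chain_inner_commute[of s])
    ultimately have "chain_inner t t + chain_inner (?D x) (?D x) = 0"
      using t by (simp add: chain_inner_simps)
    then have "chain_inner t t = 0" "chain_inner (?D x) (?D x) = 0"
      using chain_inner_self_nonneg[of t] chain_inner_self_nonneg[of "?D x"] by linarith+
    then have "t = 0" "?D x = 0" by (simp_all add: chain_inner_self_eq_0_iff)
    then show "x \<in> star_harmonic K v i j n"
      using t(2) x by (simp add: star_harmonic_def star_cycles_def chain_inner_simps)
  next
    \<comment> \<open>For harmonic \<open>x\<close> both functionals are zero, hence so are their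
      Riesz vectors.\<close>
    assume h: "x \<in> star_harmonic K v i j n"
    have "t = 0"
    proof (rule chain_inner_ext[OF subspace_star_theta t(1) subspace_0[OF subspace_star_theta]])
      show "chain_inner z t = chain_inner z 0" if "z \<in> ?T" for z
        using h t(2)[OF that] that by (simp add: star_harmonic_def chain_inner_simps)
    qed
    moreover have "s = 0"
    proof (rule chain_inner_ext[OF subspace_star_chains s(1) subspace_0[OF subspace_star_chains]])
      show "chain_inner z s = chain_inner z 0" if "z \<in> ?A" for z
        using h s(2)[OF that] by (simp add: star_harmonic_def star_cycles_def chain_inner_simps)
    qed
    ultimately show "?D' t + s = 0" by (simp add: linear_0[OF linear_star_boundary])
  qed
  with iff show ?thesis by simp
qed

lemma subspace_star_cycles: "subspace (star_cycles K v i n)"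
  unfolding star_cycles_def subspace_def using subspace_star_chains[of K v i n]
  by (auto simp: linear_0[OF linear_star_boundary] linear_add[OF linear_star_boundary]
      linear_scale[OF linear_star_boundary] subspace_0 subspace_add subspace_scale)

lemma subspace_star_harmonic: "subspace (star_harmonic K v i j n)"
  unfolding star_harmonic_def subspace_def using subspace_star_cycles[of K v i n]
  by (auto simp: chain_inner_simps subspace_0 subspace_add subspace_scale)

lemma presents_harmonic:
  assumes K: "finite_simplicial_complex (K i)" "finite_simplicial_complex (K j)" "K i \<subseteq> K j"
  shows "presents (persistent_local_harmonic K v i j n) (local_class K v i n)
    (star_harmonic K v i j n) {0}"
proof -
  have sub: "star_harmonic K v i j n \<subseteq> star_chains K v i n"
    by (auto simp: star_harmonic_def star_cycles_def)
  have "kernel (local_chains K v i n) (local_chains K v i n) (persistent_local_laplacian K v i j n) =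
      local_class K v i n ` star_harmonic K v i j n"
    unfolding kernel_def presentsD(4)[OF presents_local_chains[of K v i n]]
    using laplacian_class_eq_0_iff[of K i j _ v n, OF K] sub by auto
  moreover have "{0} \<inter> star_harmonic K v i j n = {0}"
    using subspace_0[OF subspace_star_harmonic[of K v i j n]] by auto
  ultimately show ?thesis
    using presents_subspace_on[OF presents_local_chains subspace_star_harmonic sub]
    by (simp add: persistent_local_harmonic_def)
qed

section \<open>Persistent local homology\<close>

definition star_boundaries ::
  "(int \<Rightarrow> 'a::linorder set set) \<Rightarrow> 'a \<Rightarrow> int \<Rightarrow> nat \<Rightarrow> 'a chain set" where
  "star_boundaries K v i n = star_boundary v (n + 1) ` star_chains K v i (n + 1)"

text \<open>Spelled with images under \<open>local_class\<close> so that it is literally the class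
  map that \<open>presents_quotient\<close> yields for cycles modulo boundaries.\<close>

definition homology_class ::
  "(int \<Rightarrow> 'a::linorder set set) \<Rightarrow> 'a \<Rightarrow> int \<Rightarrow> nat \<Rightarrow> 'a chain \<Rightarrow> 'a chain set set" where
  "homology_class K v i n x =
     coset (subspace_on (local_chains K v i n) (local_class K v i n ` star_cycles K v i n))
       (local_class K v i n ` star_boundaries K v i n) (local_class K v i n x)"

lemma subspace_star_boundaries: "subspace (star_boundaries K v i n)"
  unfolding star_boundaries_def
  by (intro linear_subspace_image linear_star_boundary subspace_star_chains)

lemma star_boundaries_subset:
  assumes "finite_simplicial_complex (K i)"
  shows "star_boundaries K v i n \<subseteq> star_cycles K v i n"
  using star_boundary_mem[of K i _ v "n + 1", OF assms]
  by (auto simp: star_boundaries_def star_cycles_def star_boundary_star_boundary)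

lemma rel_cycles_eq:
  assumes "finite_simplicial_complex (K i)"
  shows "rel_cycles (K i) (avoiding K v i) n = local_class K v i n ` star_cycles K v i n"
proof -
  have "local_class K v i (n - 1) (star_boundary v n x) = local_class K v i (n - 1) 0 \<longleftrightarrow>
      star_boundary v n x = 0" if "x \<in> star_chains K v i n" for x
    using star_boundary_mem[OF assms that]
    by (simp add: local_class_eq_iff subspace_0 subspace_star_chains)
  then show ?thesis
    unfolding rel_cycles_def kernel_def
      presentsD(4)[OF presents_local_chains[of K v i n, unfolded local_chains_def]]
      presentsD(5)[OF presents_local_chains[of K v i "n - 1", unfolded local_chains_def]]
      star_cycles_def
    using local_boundary_class[of K i _ v n, OF assms] by (auto simp: local_boundary_def)
qed

lemma rel_boundaries_eq:
  assumes "finite_simplicial_complex (K i)"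
  shows "rel_boundaries (K i) (avoiding K v i) n = local_class K v i n ` star_boundaries K v i n"
  unfolding rel_boundaries_def
    presentsD(4)[OF presents_local_chains[of K v i "n + 1", unfolded local_chains_def]]
    star_boundaries_def image_image
  using local_boundary_class[of K i _ v "n + 1", OF assms]
  by (intro image_cong) (auto simp: local_boundary_def)

lemma presents_star_cycles:
  "presents (subspace_on (local_chains K v i n) (local_class K v i n ` star_cycles K v i n))
     (local_class K v i n) (star_cycles K v i n) {0}"
proof -
  have "star_cycles K v i n \<subseteq> star_chains K v i n" by (auto simp: star_cycles_def)
  moreover have "{0} \<inter> star_cycles K v i n = {0}"
    using subspace_0[OF subspace_star_cycles[of K v i n]] by auto
  ultimately show ?thesis
    using presents_subspace_on[OF presents_local_chains subspace_star_cycles[of K v i n]] by simp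
qed

lemma presents_rel_homology:
  assumes K: "finite_simplicial_complex (K i)"
  shows "presents (rel_homology (K i) (avoiding K v i) n) (homology_class K v i n)
    (star_cycles K v i n) (star_boundaries K v i n)"
  using presents_quotient[OF presents_star_cycles subspace_star_boundaries _
      star_boundaries_subset[of K i v n, OF K]]
  by (simp add: rel_homology_def rel_cycles_eq rel_boundaries_eq K homology_class_def[abs_def]
      local_chains_def subspace_0 subspace_star_boundaries)

lemma star_cycles_mono: "K i \<subseteq> K j \<Longrightarrow> star_cycles K v i n \<subseteq> star_cycles K v j n"
  using star_chains_mono[of K i j v n] by (auto simp: star_cycles_def)

text \<open>On representatives the induced map is the identity, so
  \<open>presents_quotient_map\<close> applies with the identity as \<open>g\<close>.\<close>

lemma rel_homology_incl_class:
  assumes K: "finite_simplicial_complex (K i)" "finite_simplicial_complex (K j)" "K i \<subseteq> K j"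
    and x: "x \<in> star_cycles K v i n"
  shows "rel_homology_incl (K j) (avoiding K v j) n (homology_class K v i n x) =
    homology_class K v j n x"
proof -
  have F: "local_incl K v j n (local_class K v i n y) = local_class K v j n y"
    if "y \<in> star_cycles K v i n" for y
    using local_incl_class[of K i j y n v, OF K(3)] that star_chains_subset[of K v i n]
    by (auto simp: star_cycles_def)
  \<comment> \<open>Since \<open>star_boundary\<close> is the same at all stages, a chain that
    bounds at stage \<open>i\<close> also bounds at stage \<open>j\<close>.\<close>
  have B: "(\<lambda>c. c) ` star_boundaries K v i n \<subseteq> star_boundaries K v j n"
    using star_chains_mono[of K i j v "n + 1", OF K(3)] by (auto simp: star_boundaries_def)
  have Z: "(\<lambda>c. c) ` star_cycles K v i n \<subseteq> star_cycles K v j n"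
    using star_cycles_mono[of K i j v n, OF K(3)] by simp
  show ?thesis
    using presents_quotient_map[OF presents_star_cycles subspace_star_boundaries _
        star_boundaries_subset[of K i v n, OF K(1)] presents_star_cycles subspace_star_boundaries _
        star_boundaries_subset[of K j v n, OF K(2)] F linear_ident Z B x]
    by (simp add: rel_homology_incl_def rel_cycles_eq rel_boundaries_eq K homology_class_def
        subspace_0 subspace_star_boundaries flip: local_chains_def local_incl_def)
qed

text \<open>Second isomorphism theorem: a cycle of stage \<open>i\<close> becomes zero in the
  homology of stage \<open>j\<close> exactly if it bounds there.\<close>

lemma presents_persistent_homology:
  assumes K: "finite_simplicial_complex (K i)" "finite_simplicial_complex (K j)" "K i \<subseteq> K j"
  shows "presents (persistent_local_homology K v i j n) (homology_class K v j n)
    (star_cycles K v i n) (star_boundaries K v j n \<inter> star_cycles K v i n)"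
proof -
  have "rel_homology_incl (K j) (avoiding K v j) n ` vcarrier (rel_homology (K i) (avoiding K v i) n)
      = homology_class K v j n ` star_cycles K v i n"
    unfolding presentsD(4)[OF presents_rel_homology[of K i v n, OF K(1)]] image_image
    by (intro image_cong refl rel_homology_incl_class K)
  then show ?thesis
    using presents_subspace_on[OF presents_rel_homology[of K j v n, OF K(2)] subspace_star_cycles
        star_cycles_mono[of K i j v n, OF K(3)]]
    by (simp add: persistent_local_homology_def)
qed

text \<open>A boundary that lies in stage \<open>i\<close> is a cycle there, since the boundary
  squares to zero. The image of \<open>delta\<close> is thereby the subspace divided out in
  persistent homology, which links the two sides.\<close>

lemma star_boundary_theta:
  "star_boundary v (n + 1) ` star_theta K v i j n = star_boundaries K v j n \<inter> star_cycles K v i n"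
  by (auto simp: star_theta_def star_boundaries_def star_cycles_def star_boundary_star_boundary)

text \<open>Orthogonal decomposition of the cycles of stage \<open>i\<close>: the harmonic chains
  complement those cycles that bound at stage \<open>j\<close>.\<close>

lemma presents_persistent_homology_harmonic:
  assumes K: "finite_simplicial_complex (K i)" "finite_simplicial_complex (K j)" "K i \<subseteq> K j"
  shows "presents (persistent_local_homology K v i j n) (homology_class K v j n)
    (star_harmonic K v i j n) {0}"
proof (rule presents_complement[OF presents_persistent_homology[of K i j v n, OF K]])
  let ?B = "star_boundaries K v j n \<inter> star_cycles K v i n"
  have orth: "chain_inner z x = 0" if "x \<in> star_harmonic K v i j n" "z \<in> ?B" for x z
    using that unfolding star_boundary_theta[symmetric] by (auto simp: star_harmonic_def)
  show "?B \<inter> star_harmonic K v i j n \<subseteq> {0}"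
    using orth chain_inner_self_eq_0_iff by blast
  fix x assume x: "x \<in> star_cycles K v i n"
  have B: "subspace ?B"
    by (intro subspace_inter subspace_star_boundaries subspace_star_cycles)
  have "?B \<subseteq> star_chains K v i n" by (auto simp: star_cycles_def)
  \<comment> \<open>\<open>p\<close> is the orthogonal projection of \<open>x\<close> onto
    \<open>?B\<close>, so \<open>x - p\<close> is harmonic and represents the same class.\<close>
  then obtain p where p: "p \<in> ?B" "\<And>z. z \<in> ?B \<Longrightarrow> chain_inner z x = chain_inner z p"
    using star_chains_riesz[of K i ?B v n, OF K(1) B _ linear_chain_inner_left[of x]] by blast
  have "x - p \<in> star_cycles K v i n"
    using p(1) x subspace_star_cycles[of K v i n] by (auto intro: subspace_diff)
  then have "x - p \<in> star_harmonic K v i j n"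
    using p(2) unfolding star_harmonic_def star_boundary_theta[symmetric]
    by (auto simp: chain_inner_simps)
  with p(1) show "\<exists>s\<in>star_harmonic K v i j n. x - s \<in> ?B"
    by (intro bexI[of _ "x - p"]) auto
qed (rule subspace_star_harmonic, auto simp: star_harmonic_def)

theorem theorem3p27:
  fixes K :: "int \<Rightarrow> 'a::linorder set set" and v :: 'a and i j :: int and n :: nat
  assumes "persistence_complex K"
    and "{v} \<in> (\<Union>k. K k)"
    and "i \<le> j"
  shows "linearly_isomorphic (persistent_local_harmonic K v i j n)
                             (persistent_local_homology K v i j n)"
proof -
  have "finite_simplicial_complex (K i)" "finite_simplicial_complex (K j)" "K i \<subseteq> K j"
    using assms by (auto simp: persistence_complex_def)
  then show ?thesis
    by (intro presents_isomorphic[OF presents_harmonic presents_persistent_homology_harmonic])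
qed

end
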